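(* Let $(X,\|\cdot\|)$ be a Banach space, let $S\subset X$ be a non-empty closed set, and let $(\mathcal{P},\|\cdot\|_{\mathcal{P}})$ be a perturbation space on $S$. Let $f:X\to\mathbb{R}\cup\{+\infty\}$ be lower semicontinuous, bounded below on $S$, and proper on $S$ (that is, $f(x)<+\infty$ for some $x\in S$). Then for every $\varepsilon>0$ there exists $g\in\mathcal{P}$ such that $\|g\|_{\mathcal{P}}<\varepsilon$ and the minimization problem $(f+g,S)$ is well-posed modulus compact. In particular, $f+g$ attains its minimum on $S$.
   Context: All spaces are real. For a set $A\subset X$, $\alpha(A)$ denotes the Kuratowski index of non-compactness: the infimum of all $\varepsilon>0$ for which $A$ admits a finite $\varepsilon$-net, i.e. a finite set $F\subset X$ such that every point of $A$ is within distance $\varepsilon$ of $F$ (equivalently, one may use compact nets). For $S\subset X$ non-empty, $f$ a function with values in $\mathbb{R}\cup\{+\infty\}$ defined on a set containing $S$ and bounded below on $S$, and $\varepsilon\ge 0$, put $\Omega_f^S(\varepsilon)=\{x\in S: f(x)\le\inf_S f+\varepsilon\}$. The minimization problem $(f,S)$ (minimize $f(x)$ subject to $x\in S$) is well-posed modulus compact if $\inf_S f\in\mathbb{R}$, the set $\Omega_f^S(0)$ of minimizers is non-empty and compact, and for every sequence $(x_n)$ in $S$ with $f(x_n)\to\inf_S f$ one has $d(x_n,\Omega_f^S(0))\to 0$, where $d$ is the distance from a point to a set. Perturbation space: let $S\subseteq X$ be non-empty. A set $\mathcal{P}$ of real-valued functions (with a common domain $D$, $S\subseteq D\subseteq X$)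 that are continuous and bounded on $S$, together with a norm $\|\cdot\|_{\mathcal{P}}$ on $\mathrm{span}\,\mathcal{P}$, is called a perturbation space on $S$ if: (i) $\mathcal{P}$ is a convex cone; (ii) $\mathcal{P}$ is complete with respect to $\|\cdot\|_{\mathcal{P}}$, $(\mathrm{span}\,\mathcal{P},\|\cdot\|_{\mathcal{P}})$ is a Banach space, and the norm dominates uniform convergence on $S$: for some $c>0$, $\sup_{x\in S}|g(x)|\le c\|g\|_{\mathcal{P}}$ for all $g\in\mathrm{span}\,\mathcal{P}$; (iii) for every $\varepsilon>0$ there exists $\delta>0$ such that for every $x\in S$ there exists $g\in\mathcal{P}$ (depending on $x$) with $\|g\|_{\mathcal{P}}\le\varepsilon$, $x\in\Omega_g^S(\delta)$ and $\alpha(\Omega_g^S(3\delta))\le\varepsilon$. *)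

theory Defs
  imports "HOL-Analysis.Analysis" "HOL-Library.Function_Algebras"
begin

text \<open>Pointwise real vector space structure on functions; it provides \<open>span\<close> and \<open>convex_cone\<close>
  for sets of functions.\<close>

instantiation "fun" :: (type, real_vector) real_vector
begin

definition scaleR_fun :: "real \<Rightarrow> ('a \<Rightarrow> 'b) \<Rightarrow> 'a \<Rightarrow> 'b"
  where "scaleR_fun c f = (\<lambda>x. c *\<^sub>R f x)"

instance
  by standard
    (simp_all add: scaleR_fun_def fun_eq_iff scaleR_add_right scaleR_add_left)

end

text \<open>The value is taken in \<^typ>\<open>ereal\<close>, so that it is \<open>\<infinity>\<close> for unbounded sets.\<close>

definition kuratowski_index :: "'a::metric_space set \<Rightarrow> ereal"
  where "kuratowski_index A =
    (INF e \<in> {e::real. 0 < e \<and> (\<exists>F. finite F \<and> (\<forall>a\<in>A. \<exists>y\<in>F. dist a y \<le> e))}. ereal e)"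

definition Omega :: "('a \<Rightarrow> ereal) \<Rightarrow> 'a set \<Rightarrow> real \<Rightarrow> 'a set"
  where "Omega f S \<epsilon> = {x \<in> S. f x \<le> (INF y\<in>S. f y) + ereal \<epsilon>}"

definition well_posed_modulus_compact :: "('a::metric_space \<Rightarrow> ereal) \<Rightarrow> 'a set \<Rightarrow> bool"
  where "well_posed_modulus_compact f S \<longleftrightarrow>
    \<bar>INF y\<in>S. f y\<bar> \<noteq> \<infinity> \<and>
    Omega f S 0 \<noteq> {} \<and> compact (Omega f S 0) \<and>
    (\<forall>x :: nat \<Rightarrow> 'a. (\<forall>n. x n \<in> S) \<longrightarrow> (\<lambda>n. f (x n)) \<longlonglongrightarrow> (INF y\<in>S. f y) \<longrightarrow>
      (\<lambda>n. infdist (x n) (Omega f S 0)) \<longlonglongrightarrow> 0)"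

definition lower_semicontinuous :: "('a::topological_space \<Rightarrow> ereal) \<Rightarrow> bool"
  where "lower_semicontinuous f \<longleftrightarrow> (\<forall>x. \<forall>a < f x. \<forall>\<^sub>F y in nhds x. a < f y)"

text \<open>Norms on a subspace \<open>V\<close> and completeness of a subset of \<open>V\<close>. The values of \<open>N\<close> outside \<open>V\<close>
  are irrelevant.\<close>

definition norm_on :: "'v::real_vector set \<Rightarrow> ('v \<Rightarrow> real) \<Rightarrow> bool"
  where "norm_on V N \<longleftrightarrow>
    (\<forall>g\<in>V. 0 \<le> N g) \<and>
    (\<forall>g\<in>V. N g = 0 \<longleftrightarrow> g = 0) \<and>
    (\<forall>g\<in>V. \<forall>c. N (c *\<^sub>R g) = \<bar>c\<bar> * N g) \<and>
    (\<forall>g\<in>V. \<forall>h\<in>V. N (g + h) \<le> N g + N h)"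

definition complete_wrt :: "('v::real_vector \<Rightarrow> real) \<Rightarrow> 'v set \<Rightarrow> bool"
  where "complete_wrt N A \<longleftrightarrow>
    (\<forall>u :: nat \<Rightarrow> 'v. (\<forall>n. u n \<in> A) \<longrightarrow>
      (\<forall>e>0. \<exists>M. \<forall>m\<ge>M. \<forall>n\<ge>M. N (u m - u n) < e) \<longrightarrow>
      (\<exists>g\<in>A. (\<lambda>n. N (u n - g)) \<longlonglongrightarrow> 0))"

text \<open>A real-valued function on the common domain \<open>D\<close> is encoded as a total function that vanishes
  outside \<open>D\<close>. This is a bijective encoding compatible with pointwise addition and scaling, so that
  \<open>span P\<close> and \<open>g = 0\<close> have their meaning as for functions on \<open>D\<close>.\<close>

definition perturbation_space ::
    "'a::metric_space set \<Rightarrow> 'a set \<Rightarrow> ('a \<Rightarrow> real) set \<Rightarrow> (('a \<Rightarrow> real) \<Rightarrow> real) \<Rightarrow> bool"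
  where "perturbation_space D S P N \<longleftrightarrow>
    S \<noteq> {} \<and> S \<subseteq> D \<and>
    (\<forall>g\<in>P. \<forall>x. x \<notin> D \<longrightarrow> g x = 0) \<and>
    (\<forall>g\<in>P. continuous_on S g \<and> bounded (g ` S)) \<and>
    convex_cone P \<and>
    norm_on (span P) N \<and>
    complete_wrt N P \<and> complete_wrt N (span P) \<and>
    (\<exists>c>0. \<forall>g\<in>span P. (SUP x\<in>S. \<bar>g x\<bar>) \<le> c * N g) \<and>
    (\<forall>\<epsilon>>0. \<exists>\<delta>>0. \<forall>x\<in>S. \<exists>g\<in>P.
      N g \<le> \<epsilon> \<and> x \<in> Omega (\<lambda>y. ereal (g y)) S \<delta> \<and>
      kuratowski_index (Omega (\<lambda>y. ereal (g y)) S (3 * \<delta>)) \<le> ereal \<epsilon>)"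

end

theory Submission
  imports Defs
begin

text \<open>Perturb \<open>f\<close> successively: given the current function \<open>F\<close>, take \<open>x\<close> nearly minimizing \<open>F\<close>
  and a small \<open>g\<close> nearly minimized at \<open>x\<close> whose near-minimizers have small index of
  non-compactness; the near-minimizers of \<open>F + g\<close> are near-minimizers of \<open>g\<close>. If every later
  perturbation is small compared with the slack gained so far, these smallness properties survive
  in the limit. Hence minimizing sequences of the limit function are totally bounded, and
  completeness together with lower semicontinuity gives well-posedness.\<close>

section \<open>Finite nets and total boundedness\<close>

definition has_finite_net :: "real \<Rightarrow> 'a::metric_space set \<Rightarrow> bool"
  where "has_finite_net e A \<longleftrightarrow> (\<exists>K. finite K \<and> (\<forall>a\<in>A. \<exists>y\<in>K. dist a y \<le> e))"

lemma has_finite_net_mono: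
  assumes "has_finite_net e A" "B \<subseteq> A" "e \<le> e'"
  shows "has_finite_net e' B"
proof -
  obtain K where K: "finite K" "\<forall>a\<in>A. \<exists>y\<in>K. dist a y \<le> e"
    using assms(1) unfolding has_finite_net_def by blast
  then have "\<forall>a\<in>B. \<exists>y\<in>K. dist a y \<le> e'"
    using assms(2,3) by (meson order_trans subsetD)
  then show ?thesis
    unfolding has_finite_net_def using K(1) by blast
qed

text \<open>The infimum defining the index need not be attained, so a net is only guaranteed at
  radii strictly above the bound.\<close>

lemma has_finite_net_if_kuratowski_index:
  assumes "kuratowski_index A \<le> ereal e" "e < e'"
  shows "has_finite_net e' A"
proof -
  have "kuratowski_index A < ereal e'"
    using assms by (meson ereal_less_eq(3) less_ereal.simps(1) le_less_trans)
  then obtain r where r: "r < e'" "\<exists>K. finite K \<and> (\<forall>a\<in>A. \<exists>y\<in>K. dist a y \<le> r)"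
    unfolding kuratowski_index_def INF_less_iff by auto
  then show ?thesis
    using has_finite_net_mono[of r A A e'] unfolding has_finite_net_def by auto
qed

text \<open>Each net covers only a tail of the sequence, but adding the finitely many earlier terms
  gives a net of the whole range. Its closure is therefore totally bounded and complete, hence
  compact.\<close>

lemma convergent_subsequence_if_finite_nets:
  fixes x :: "nat \<Rightarrow> 'a::complete_space"
  assumes "\<And>e. e > 0 \<Longrightarrow> \<exists>A. has_finite_net e A \<and> (\<forall>\<^sub>F n in sequentially. x n \<in> A)"
  obtains l r where "strict_mono (r :: nat \<Rightarrow> nat)" "(x \<circ> r) \<longlonglongrightarrow> l"
proof -
  have "\<exists>k. finite k \<and> closure (range x) \<subseteq> (\<Union>z\<in>k. ball z e)" if "e > 0" for e
  proof -
    \<comment> \<open>Two errors of size \<open>e/3\<close>, one from the net and one from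
      approximating a closure point, stay strictly below \<open>e\<close>, as open balls
      require.\<close>
    obtain A N where A: "has_finite_net (e/3) A" and N: "\<And>n. n \<ge> N \<Longrightarrow> x n \<in> A"
      using assms[of "e/3"] \<open>e > 0\<close> by (auto simp: eventually_sequentially)
    obtain K where K: "finite K" "\<forall>a\<in>A. \<exists>y\<in>K. dist a y \<le> e/3"
      using A unfolding has_finite_net_def by blast
    define k where "k = K \<union> x ` {..<N}"
    have near: "\<exists>z\<in>k. dist (x n) z \<le> e/3" for n
    proof (cases "n < N")
      case True
      then have "x n \<in> k" by (auto simp: k_def)
      then show ?thesis using that by (intro bexI[of _ "x n"]) auto
    next
      case False
      then show ?thesis using N K unfolding k_def by (meson UnI1 not_less)
    qed
    have "\<exists>z\<in>k. dist z y < e" if y: "y \<in> closure (range x)" for y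
    proof -
      obtain n where n: "dist (x n) y < e/3"
        using y \<open>e > 0\<close> unfolding closure_approachable by (metis divide_pos_pos imageE zero_less_numeral)
      obtain z where z: "z \<in> k" "dist (x n) z \<le> e/3" using near by blast
      have "dist z y \<le> dist (x n) z + dist (x n) y"
        by (metis dist_commute dist_triangle2)
      then show ?thesis using n z \<open>e > 0\<close> by (intro bexI[of _ z]) auto
    qed
    moreover have "finite k" by (simp add: k_def K)
    ultimately show ?thesis by (intro exI[of _ k]) (auto simp: subset_iff)
  qed
  then have "compact (closure (range x))"
    unfolding compact_eq_totally_bounded by (simp add: complete_eq_closed)
  then have "seq_compact (closure (range x))"
    by (rule compact_imp_seq_compact)
  moreover have "\<forall>n. x n \<in> closure (range x)"
    by (meson closure_subset rangeI subsetD)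
  ultimately show ?thesis
    using that by (meson seq_compactE)
qed

section \<open>Near-minimizers and their perturbations\<close>

text \<open>Pairwise comparison of values replaces the infimum, so that later inclusions reduce to
  arithmetic. The finite \<open>t\<close> can be moved across the inequality even when the infimum
  is infinite.\<close>

lemma mem_Omega_iff:
  "x \<in> Omega F S t \<longleftrightarrow> x \<in> S \<and> (\<forall>z\<in>S. F x \<le> F z + ereal t)"
proof -
  have "F x \<le> (INF y\<in>S. F y) + ereal t \<longleftrightarrow> F x - ereal t \<le> (INF y\<in>S. F y)"
    by (simp add: ereal_minus_le_iff add.commute)
  also have "\<dots> \<longleftrightarrow> (\<forall>z\<in>S. F x \<le> F z + ereal t)"
    by (simp add: le_INF_iff ereal_minus_le_iff add.commute)
  finally show ?thesis unfolding Omega_def by simp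
qed

text \<open>The error \<open>d\<close> is paid twice: once at the near-minimizer and once at its
  competitor.\<close>

lemma Omega_perturbation_subset:
  fixes g h :: "'a \<Rightarrow> real"
  assumes close: "\<And>x. x \<in> S \<Longrightarrow> \<bar>g x - h x\<bar> \<le> d"
  shows "Omega (\<lambda>x. f x + ereal (g x)) S t \<subseteq> Omega (\<lambda>x. f x + ereal (h x)) S (t + 2 * d)"
proof
  fix y assume y: "y \<in> Omega (\<lambda>x. f x + ereal (g x)) S t"
  have "f y + ereal (h y) \<le> f z + ereal (h z) + ereal (t + 2 * d)" if "z \<in> S" for z
  proof -
    have "f y + ereal (g y) \<le> f z + ereal (g z) + ereal t"
      using y that by (auto simp: mem_Omega_iff)
    moreover have "\<bar>g y - h y\<bar> \<le> d" "\<bar>g z - h z\<bar> \<le> d"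
      using y that close by (auto simp: mem_Omega_iff)
    ultimately show ?thesis
      by (cases "f y"; cases "f z") auto
  qed
  then show "y \<in> Omega (\<lambda>x. f x + ereal (h x)) S (t + 2 * d)"
    using y by (auto simp: mem_Omega_iff)
qed

text \<open>Finiteness of \<open>F x\<close> forces that of \<open>F y\<close>, so these values
  cancel and leave \<open>g y \<le> g x + 2 * t\<close>; near-minimality of \<open>x\<close> for
  \<open>g\<close> costs one more \<open>t\<close>. This explains the level
  \<open>3 * \<delta>\<close> in the notion of perturbation space.\<close>

lemma Omega_add_subset:
  fixes g :: "'a \<Rightarrow> real"
  assumes "x \<in> Omega F S t" "x \<in> Omega (\<lambda>y. ereal (g y)) S t" "\<bar>F x\<bar> \<noteq> \<infinity>"
  shows "Omega (\<lambda>y. F y + ereal (g y)) S t \<subseteq> Omega (\<lambda>y. ereal (g y)) S (3 * t)"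
proof
  fix y assume y: "y \<in> Omega (\<lambda>y. F y + ereal (g y)) S t"
  have "g y \<le> g z + 3 * t" if "z \<in> S" for z
  proof -
    have "F y + ereal (g y) \<le> F x + ereal (g x) + ereal t"
      using assms y by (auto simp: mem_Omega_iff)
    moreover have "F x \<le> F y + ereal t"
      using assms y by (auto simp: mem_Omega_iff)
    moreover have "g x \<le> g z + t"
      using assms(2) that by (auto simp: mem_Omega_iff)
    ultimately show ?thesis
      using assms(3) by (cases "F x"; cases "F y") auto
  qed
  then show "y \<in> Omega (\<lambda>y. ereal (g y)) S (3 * t)"
    using y by (auto simp: mem_Omega_iff)
qed

section \<open>Well-posedness from nets of near-minimizers\<close>

text \<open>The nets make every minimizing sequence subconverge, and \<open>lsc\<close> makes the
  limit a minimizer. Existence, compactness and the distance condition all follow from this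
  \<open>cluster\<close> property.\<close>

lemma well_posed_modulus_compactI:
  fixes F :: "'a::complete_space \<Rightarrow> ereal"
  assumes "closed S" "S \<noteq> {}" and inf_finite: "\<bar>INF y\<in>S. F y\<bar> \<noteq> \<infinity>"
    and lsc: "\<And>x l. (\<And>n. x n \<in> S) \<Longrightarrow> x \<longlonglongrightarrow> l \<Longrightarrow>
      (\<lambda>n. F (x n)) \<longlonglongrightarrow> (INF y\<in>S. F y) \<Longrightarrow> F l \<le> (INF y\<in>S. F y)"
    and net: "\<And>e. e > 0 \<Longrightarrow> \<exists>t>0. has_finite_net e (Omega F S t)"
  shows "well_posed_modulus_compact F S"
proof -
  let ?I = "INF y\<in>S. F y" and ?M = "Omega F S 0"
  have cluster: "\<exists>l r. l \<in> ?M \<and> strict_mono r \<and> (x \<circ> r) \<longlonglongrightarrow> l"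
    if x: "\<And>n. x n \<in> S" and lim: "(\<lambda>n. F (x n)) \<longlonglongrightarrow> ?I" for x :: "nat \<Rightarrow> 'a"
  proof -
    have "\<exists>A. has_finite_net e A \<and> (\<forall>\<^sub>F n in sequentially. x n \<in> A)" if "e > 0" for e
    proof -
      obtain t where t: "t > 0" "has_finite_net e (Omega F S t)"
        using net \<open>e > 0\<close> by blast
      \<comment> \<open>Strictness needs a finite infimum; it is what brings a minimizing sequence
        into \<open>Omega F S t\<close> eventually.\<close>
      have "?I < ?I + ereal t"
        using inf_finite t by (cases ?I) auto
      then have "\<forall>\<^sub>F n in sequentially. F (x n) < ?I + ereal t"
        using lim order_tendstoD(2) by blast
      then have "\<forall>\<^sub>F n in sequentially. x n \<in> Omega F S t"
        by eventually_elim (simp add: Omega_def x)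
      then show ?thesis using t by blast
    qed
    then obtain l r where lr: "strict_mono r" "(x \<circ> r) \<longlonglongrightarrow> l"
      using convergent_subsequence_if_finite_nets by blast
    have "l \<in> S"
      using \<open>closed S\<close> lr(2) x by (metis closed_sequentially comp_apply)
    moreover have "(\<lambda>n. F ((x \<circ> r) n)) \<longlonglongrightarrow> ?I"
      using LIMSEQ_subseq_LIMSEQ[OF lim lr(1)] by (simp add: o_def)
    then have "F l \<le> ?I"
      using lsc[of "x \<circ> r"] lr(2) x by simp
    ultimately have "l \<in> ?M" by (simp add: Omega_def)
    then show ?thesis using lr by blast
  qed
  have nonempty: "?M \<noteq> {}"
  proof -
    have "F ` S \<noteq> {}" using \<open>S \<noteq> {}\<close> by simp
    then obtain u where u: "\<forall>n. u n \<in> F ` S" "u \<longlonglongrightarrow> ?I"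
      using Inf_as_limit[of "F ` S"] by blast
    have "\<exists>y. y \<in> S \<and> u n = F y" for n
      using u(1)[rule_format, of n] by blast
    then obtain x where x: "\<And>n. x n \<in> S" "\<And>n. u n = F (x n)" by metis
    then have "(\<lambda>n. F (x n)) \<longlonglongrightarrow> ?I" using u(2) by presburger
    then show ?thesis using cluster[of x, OF x(1)] by blast
  qed
  have eq: "F y = ?I" if "y \<in> ?M" for y
  proof (rule antisym)
    show "F y \<le> ?I" using that by (simp add: Omega_def)
    show "?I \<le> F y" using that by (intro INF_lower) (simp add: Omega_def)
  qed
  have "seq_compact ?M"
  proof (rule seq_compactI)
    fix x :: "nat \<Rightarrow> 'a" assume x: "\<forall>n. x n \<in> ?M"
    then have xS: "x n \<in> S" for n by (simp add: Omega_def)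
    \<comment> \<open>A sequence of minimizers has constant values and is thus itself
      minimizing.\<close>
    have xlim: "(\<lambda>n. F (x n)) \<longlonglongrightarrow> ?I"
      unfolding eq[OF x[rule_format]] by (rule tendsto_const)
    show "\<exists>l\<in>?M. \<exists>r. strict_mono r \<and> (x \<circ> r) \<longlonglongrightarrow> l"
      using cluster[of x, OF xS xlim] by blast
  qed
  then have "compact ?M" by (simp add: compact_eq_seq_compact_metric)
  moreover have "(\<lambda>n. infdist (x n) ?M) \<longlonglongrightarrow> 0"
    if x: "\<And>n. x n \<in> S" and lim: "(\<lambda>n. F (x n)) \<longlonglongrightarrow> ?I" for x :: "nat \<Rightarrow> 'a"
  proof (rule ccontr)
    assume "\<not> ?thesis"
    then obtain e where e: "e > 0" "\<not> (\<forall>\<^sub>F n in sequentially. dist (infdist (x n) ?M) 0 < e)"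
      unfolding tendsto_iff by blast
    then have "\<not> (\<forall>\<^sub>F n in sequentially. infdist (x n) ?M < e)"
      by (simp add: infdist_nonneg)
    \<comment> \<open>A subsequence staying \<open>e\<close> away from the minimizers is still
      minimizing, so it would have to cluster at one of them.\<close>
    then obtain r where r: "strict_mono (r :: nat \<Rightarrow> nat)" "\<forall>n. \<not> infdist (x (r n)) ?M < e"
      using not_eventually_sequentiallyD by blast
    have "(\<lambda>n. F ((x \<circ> r) n)) \<longlonglongrightarrow> ?I"
      using LIMSEQ_subseq_LIMSEQ[OF lim r(1)] by (simp add: o_def)
    then obtain l s where l: "l \<in> ?M" "(x \<circ> r \<circ> s) \<longlonglongrightarrow> l"
      using cluster[of "x \<circ> r"] x by (metis comp_apply)
    have "\<exists>n. dist ((x \<circ> r \<circ> s) n) l < e"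
      using l(2) e(1) unfolding lim_sequentially by blast
    then obtain n where "dist (x (r (s n))) l < e" by auto
    then have "infdist (x (r (s n))) ?M < e"
      using infdist_le[OF l(1), of "x (r (s n))"] by linarith
    then show False using r(2) by blast
  qed
  ultimately show ?thesis
    unfolding well_posed_modulus_compact_def using inf_finite nonempty by blast
qed

section \<open>Lower semicontinuity along sequences\<close>

lemma lower_semicontinuous_le_lim:
  assumes "lower_semicontinuous f" "x \<longlonglongrightarrow> l" "(\<lambda>n. f (x n)) \<longlonglongrightarrow> L"
  shows "f l \<le> L"
proof (rule ccontr)
  assume "\<not> f l \<le> L"
  then obtain b where b: "L < b" "b < f l" using dense by (metis not_le)
  then have "\<forall>\<^sub>F y in nhds l. b < f y"
    using assms(1) unfolding lower_semicontinuous_def by blast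
  then have "\<forall>\<^sub>F n in sequentially. b < f (x n)"
    using assms(2) unfolding filterlim_iff by blast
  moreover have "\<forall>\<^sub>F n in sequentially. f (x n) < b"
    using assms(3) b(1) order_tendstoD(2) by blast
  ultimately have "\<forall>\<^sub>F n in sequentially. False"
    by eventually_elim auto
  then show False by simp
qed

text \<open>Continuity on \<open>S\<close> makes \<open>g (x n)\<close> converge, so subtracting it
  isolates \<open>f\<close>. The subtraction cancels even where \<open>f\<close> is infinite,
  because \<open>g\<close> is real-valued.\<close>

lemma lower_semicontinuous_add_le_lim:
  fixes g :: "'a::metric_space \<Rightarrow> real"
  assumes lsc: "lower_semicontinuous f" and cont: "continuous_on S g"
    and S: "\<And>n. x n \<in> S" "l \<in> S" and x: "x \<longlonglongrightarrow> l"
    and lim: "(\<lambda>n. f (x n) + ereal (g (x n))) \<longlonglongrightarrow> L"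
  shows "f l + ereal (g l) \<le> L"
proof -
  have "(\<lambda>n. g (x n)) \<longlonglongrightarrow> g l"
    using cont S x by (auto simp: continuous_on_sequentially o_def)
  then have "(\<lambda>n. (f (x n) + ereal (g (x n))) - ereal (g (x n))) \<longlonglongrightarrow> L - ereal (g l)"
    using lim by (intro tendsto_diff_ereal_general) auto
  moreover have "(a + ereal b) - ereal b = a" for a b
    by (cases a) auto
  ultimately have "f l \<le> L - ereal (g l)"
    using lower_semicontinuous_le_lim[OF lsc x] by simp
  then show ?thesis by (simp add: ereal_le_minus_iff)
qed

section \<open>Finite infima and a single perturbation\<close>

lemma INF_finite_if_bounded_below:
  fixes F :: "'a \<Rightarrow> ereal"
  assumes "\<And>x. x \<in> S \<Longrightarrow> ereal m \<le> F x" "w \<in> S" "F w < \<infinity>"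
  shows "\<bar>INF y\<in>S. F y\<bar> \<noteq> \<infinity>"
proof -
  have "ereal m \<le> (INF y\<in>S. F y)" using assms(1) by (simp add: le_INF_iff)
  moreover have "(INF y\<in>S. F y) \<le> F w" using assms(2) by (rule INF_lower)
  ultimately show ?thesis using assms(3) by auto
qed

text \<open>Provides the point with finite value that the cancellation in
  \<open>Omega_add_subset\<close> requires.\<close>

lemma finite_value_in_Omega:
  fixes F :: "'a \<Rightarrow> ereal"
  assumes fin: "\<bar>INF y\<in>S. F y\<bar> \<noteq> \<infinity>" and "t > 0"
  obtains x where "x \<in> Omega F S t" "\<bar>F x\<bar> \<noteq> \<infinity>"
proof -
  have "(INF y\<in>S. F y) < (INF y\<in>S. F y) + ereal t"
    using assms by (cases "INF y\<in>S. F y") auto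
  then obtain x where x: "x \<in> S" "F x < (INF y\<in>S. F y) + ereal t"
    unfolding INF_less_iff by blast
  moreover have "(INF y\<in>S. F y) \<le> F x" using x(1) by (rule INF_lower)
  ultimately have "\<bar>F x\<bar> \<noteq> \<infinity>" using fin by auto
  then show ?thesis using that[of x] x by (simp add: Omega_def)
qed

lemma INF_add_bounded_finite:
  fixes g :: "'a \<Rightarrow> real"
  assumes m: "\<And>x. x \<in> S \<Longrightarrow> ereal m \<le> f x" and w: "w \<in> S" "f w < \<infinity>" and "bounded (g ` S)"
  shows "\<bar>INF y\<in>S. f y + ereal (g y)\<bar> \<noteq> \<infinity>"
proof -
  obtain B where "\<And>x. x \<in> S \<Longrightarrow> \<bar>g x\<bar> \<le> B"
    using \<open>bounded (g ` S)\<close> by (auto simp: bounded_iff)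
  then have "ereal (m - B) \<le> f x + ereal (g x)" if "x \<in> S" for x
    using m[OF that] that by (cases "f x") force+
  moreover have "f w + ereal (g w) < \<infinity>" using w(2) by auto
  ultimately show ?thesis using w(1) by (intro INF_finite_if_bounded_below)
qed

text \<open>The level \<open>t\<close> supplied by the perturbation space is uniform in the point,
  so it can be fixed first and \<open>x\<close> chosen afterwards as a near-minimizer of
  \<open>F\<close> at that level. The factor 2 leaves room for an index that is not
  attained.\<close>

lemma perturbation_step:
  fixes F :: "'a::metric_space \<Rightarrow> ereal"
  assumes pert: "perturbation_space D S P N" and fin: "\<bar>INF y\<in>S. F y\<bar> \<noteq> \<infinity>" and "\<eta> > 0"
  obtains g t where "g \<in> P" "N g \<le> \<eta>" "t > 0"
    "has_finite_net (2 * \<eta>) (Omega (\<lambda>y. F y + ereal (g y)) S t)"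
proof -
  obtain t where t: "t > 0" "\<forall>x\<in>S. \<exists>g\<in>P. N g \<le> \<eta> \<and> x \<in> Omega (\<lambda>y. ereal (g y)) S t \<and>
      kuratowski_index (Omega (\<lambda>y. ereal (g y)) S (3 * t)) \<le> ereal \<eta>"
    using pert \<open>\<eta> > 0\<close> unfolding perturbation_space_def by blast
  obtain x where x: "x \<in> Omega F S t" "\<bar>F x\<bar> \<noteq> \<infinity>"
    using finite_value_in_Omega[OF fin t(1)] by blast
  then have "x \<in> S" by (simp add: Omega_def)
  then obtain g where g: "g \<in> P" "N g \<le> \<eta>" "x \<in> Omega (\<lambda>y. ereal (g y)) S t"
      "kuratowski_index (Omega (\<lambda>y. ereal (g y)) S (3 * t)) \<le> ereal \<eta>"
    using t(2) by blast
  have "has_finite_net (2 * \<eta>) (Omega (\<lambda>y. ereal (g y)) S (3 * t))"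
    using g(4) \<open>\<eta> > 0\<close> by (intro has_finite_net_if_kuratowski_index) auto
  then have "has_finite_net (2 * \<eta>) (Omega (\<lambda>y. F y + ereal (g y)) S t)"
    using Omega_add_subset[OF x(1) g(3) x(2)] has_finite_net_mono by blast
  then show ?thesis using that g t(1) by blast
qed

section \<open>Limits of sequences with a controlled norm budget\<close>

lemma norm_on_minus_commute:
  assumes "norm_on V N" "subspace V" "g \<in> V" "h \<in> V"
  shows "N (g - h) = N (h - g)"
proof -
  have "N ((-1) *\<^sub>R (h - g)) = \<bar>-1\<bar> * N (h - g)"
    using assms unfolding norm_on_def by (meson subspace_diff)
  then show ?thesis by simp
qed

lemma norm_on_diff_triangle:
  assumes "norm_on V N" "subspace V" "g \<in> V" "h \<in> V" "k \<in> V"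
  shows "N (g - k) \<le> N (g - h) + N (h - k)"
proof -
  have "N ((g - h) + (h - k)) \<le> N (g - h) + N (h - k)"
    using assms unfolding norm_on_def by (meson subspace_diff)
  then show ?thesis by simp
qed

text \<open>Here \<open>r n\<close> is a budget for all steps from \<open>n\<close> on: the step
  lengths telescope, so the sequence is Cauchy and its limit stays within \<open>r n\<close> of
  \<open>u n\<close>.\<close>

lemma norm_on_controlled_limit:
  assumes norm: "norm_on V N" "subspace V" and "complete_wrt N A" "A \<subseteq> V"
    and u: "\<And>n. u n \<in> A" and r: "r \<longlonglongrightarrow> 0" "\<And>n. r n \<ge> (0::real)"
    and step: "\<And>n. N (u (Suc n) - u n) \<le> r n - r (Suc n)"
  obtains g where "g \<in> A" "\<And>n. N (g - u n) \<le> r n"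
proof -
  have uV: "u n \<in> V" for n using u \<open>A \<subseteq> V\<close> by blast
  \<comment> \<open>Retaining the term \<open>r (n + k)\<close> is what lets the induction
    telescope.\<close>
  have tele: "N (u (n + k) - u n) \<le> r n - r (n + k)" for n k
  proof (induction k)
    case 0
    have "N 0 = 0"
      using norm(1) subspace_0[OF norm(2)] unfolding norm_on_def by simp
    then show ?case by simp
  next
    case (Suc k)
    have "N (u (n + Suc k) - u n) \<le> N (u (n + Suc k) - u (n + k)) + N (u (n + k) - u n)"
      using norm uV by (intro norm_on_diff_triangle)
    then show ?case using Suc.IH step[of "n + k"] by simp
  qed
  have bound: "N (u m - u n) \<le> r n" if "n \<le> m" for m n
    using tele[of n "m - n"] r(2)[of m] that by simp
  have "\<exists>M. \<forall>m\<ge>M. \<forall>n\<ge>M. N (u m - u n) < e" if "e > 0" for e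
  proof -
    obtain M where "\<forall>n\<ge>M. norm (r n) < e"
      using LIMSEQ_D[OF r(1) \<open>e > 0\<close>] by auto
    then have M: "r n < e" if "n \<ge> M" for n using that by fastforce
    have "N (u m - u n) < e" if "m \<ge> M" "n \<ge> M" for m n
    proof (cases "n \<le> m")
      case True
      then show ?thesis using bound M[OF that(2)] by fastforce
    next
      case False
      then have "N (u m - u n) \<le> r m"
        using bound[of m n] norm_on_minus_commute[OF norm uV uV, of m n] by simp
      then show ?thesis using M[OF that(1)] by linarith
    qed
    then show ?thesis by blast
  qed
  then obtain g where g: "g \<in> A" "(\<lambda>n. N (u n - g)) \<longlonglongrightarrow> 0"
    using \<open>complete_wrt N A\<close> u unfolding complete_wrt_def by blast
  have gV: "g \<in> V" using g \<open>A \<subseteq> V\<close> by blast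
  have "N (g - u n) \<le> r n" for n
  proof -
    \<comment> \<open>Letting \<open>m\<close> tend to infinity removes \<open>N (u m - g)\<close>
      and leaves the bound \<open>r n\<close>.\<close>
    have "\<forall>\<^sub>F m in sequentially. N (g - u n) \<le> N (u m - g) + r n"
      using eventually_ge_at_top[of n]
    proof eventually_elim
      case (elim m)
      have "N (g - u n) \<le> N (g - u m) + N (u m - u n)"
        using norm uV gV by (intro norm_on_diff_triangle)
      then show ?case
        using bound[OF elim] norm_on_minus_commute[OF norm gV uV, of m] by simp
    qed
    moreover have "(\<lambda>m. N (u m - g) + r n) \<longlonglongrightarrow> 0 + r n"
      using g(2) by (intro tendsto_intros)
    ultimately have "N (g - u n) \<le> 0 + r n"
      by (intro tendsto_lowerbound[of _ "0 + r n" sequentially]) auto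
    then show ?thesis by simp
  qed
  then show ?thesis using that g(1) by blast
qed

section \<open>Iterated perturbation and passage to the limit\<close>

theorem theorem2p3:
  fixes S D :: "'a::banach set"
    and P :: "('a \<Rightarrow> real) set"
    and N :: "('a \<Rightarrow> real) \<Rightarrow> real"
    and f :: "'a \<Rightarrow> ereal"
    and \<epsilon> :: real
  assumes "S \<noteq> {}" and "closed S"
    and "perturbation_space D S P N"
    and "\<forall>x. f x \<noteq> -\<infinity>"
    and "lower_semicontinuous f"
    and "\<exists>m::real. \<forall>x\<in>S. ereal m \<le> f x"
    and "\<exists>x\<in>S. f x < \<infinity>"
    and "\<epsilon> > 0"
  shows "\<exists>g\<in>P. N g < \<epsilon> \<and>
    well_posed_modulus_compact (\<lambda>x. f x + ereal (g x)) S \<and>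
    (\<exists>x\<in>S. \<forall>y\<in>S. f x + ereal (g x) \<le> f y + ereal (g y))"
proof -
  obtain m where m: "\<And>x. x \<in> S \<Longrightarrow> ereal m \<le> f x" using assms by blast
  obtain w where w: "w \<in> S" "f w < \<infinity>" using assms by blast
  have PS: "\<And>g. g \<in> P \<Longrightarrow> continuous_on S g" "\<And>g. g \<in> P \<Longrightarrow> bounded (g ` S)"
      "convex_cone P" and norm: "norm_on (span P) N" and complete: "complete_wrt N P"
    using assms(3) unfolding perturbation_space_def by blast+
  obtain c where c: "c > 0" "\<And>g. g \<in> span P \<Longrightarrow> (SUP x\<in>S. \<bar>g x\<bar>) \<le> c * N g"
    using assms(3) unfolding perturbation_space_def by blast
  have fin: "\<bar>INF y\<in>S. f y + ereal (g y)\<bar> \<noteq> \<infinity>" if "g \<in> P" for g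
    using m w PS(2)[OF that] by (rule INF_add_bounded_finite)
  \<comment> \<open>A real supremum is known to dominate its members only for sets bounded above,
    hence the use of boundedness of \<open>g\<close> and \<open>h\<close> on
    \<open>S\<close>.\<close>
  have diff_bound: "\<bar>g x - h x\<bar> \<le> c * N (g - h)" if "g \<in> P" "h \<in> P" "x \<in> S" for g h x
  proof -
    obtain B C where "\<And>x. x \<in> S \<Longrightarrow> \<bar>g x\<bar> \<le> B" "\<And>x. x \<in> S \<Longrightarrow> \<bar>h x\<bar> \<le> C"
      using PS(2)[OF \<open>g \<in> P\<close>] PS(2)[OF \<open>h \<in> P\<close>] by (auto simp: bounded_iff)
    then have "\<bar>(g - h) x\<bar> \<le> B + C" if "x \<in> S" for x
      using that by (force simp: fun_diff_def)
    then have "bdd_above ((\<lambda>x. \<bar>(g - h) x\<bar>) ` S)" by (auto intro!: bdd_aboveI2)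
    then have "\<bar>(g - h) x\<bar> \<le> (SUP x\<in>S. \<bar>(g - h) x\<bar>)" using that by (intro cSUP_upper)
    also have "\<dots> \<le> c * N (g - h)"
      using that(1,2) by (intro c(2) span_diff span_base)
    finally show ?thesis by (simp add: fun_diff_def)
  qed
  \<comment> \<open>The second component is the total norm still available for later perturbations.\<close>
  define inv where "inv n p \<longleftrightarrow> fst p \<in> P \<and> 0 < snd p \<and> snd p \<le> \<epsilon> / 2 / 2 ^ n \<and>
      (n > 0 \<longrightarrow> has_finite_net (\<epsilon> / 2 ^ n) (Omega (\<lambda>y. f y + ereal (fst p y)) S (4 * c * snd p)))
      \<and> (n = 0 \<longrightarrow> p = (0, \<epsilon> / 2))" for n p
  have "inv 0 (0, \<epsilon> / 2)"
    using assms(8) convex_cone_contains_0[OF PS(3)] by (simp add: inv_def)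
  then have "\<exists>p. inv 0 p" ..
  moreover have "\<exists>q. inv (Suc n) q \<and> N (fst q - fst p) \<le> snd p - snd q"
    if p: "inv n p" for n p
  proof -
    let ?h = "fst p" and ?r = "snd p"
    have h: "?h \<in> P" "?r > 0" "?r \<le> \<epsilon> / 2 / 2 ^ n" using p by (auto simp: inv_def)
    \<comment> \<open>At most half of the budget \<open>?r\<close> is spent on \<open>g\<close>. The
      net radius is then \<open>?r\<close>, which is at most
      \<open>\<epsilon> / 2 ^ Suc n\<close>.\<close>
    obtain g t where g: "g \<in> P" "N g \<le> ?r / 2" "t > 0" and
      net: "has_finite_net (2 * (?r / 2)) (Omega (\<lambda>y. f y + ereal (?h y) + ereal (g y)) S t)"
      using perturbation_step[OF assms(3) fin[OF h(1)], of "?r / 2"] h(2) by auto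
    \<comment> \<open>The first bound keeps \<open>r'\<close> within what \<open>g\<close> leaves of
      the budget. The second makes the slack \<open>t\<close> at least \<open>4 * c * r'\<close>,
      while later perturbations change values on \<open>S\<close> by at most
      \<open>c * r'\<close>.\<close>
    define r' where "r' = min (?r / 2) (t / (4 * c))"
    have r': "r' > 0" "r' \<le> ?r / 2" "4 * c * r' \<le> t"
      using h(2) g(3) c(1) by (auto simp: r'_def min_def field_simps)
    have "Omega (\<lambda>y. f y + ereal ((?h + g) y)) S (4 * c * r')
        \<subseteq> Omega (\<lambda>y. f y + ereal (?h y) + ereal (g y)) S t"
      using r'(3) by (fastforce simp: mem_Omega_iff add.assoc intro: order_trans add_left_mono)
    then have "has_finite_net (\<epsilon> / 2 ^ Suc n)
        (Omega (\<lambda>y. f y + ereal ((?h + g) y)) S (4 * c * r'))"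
      using net h(3) by (elim has_finite_net_mono) (auto simp: field_simps)
    moreover have "r' \<le> \<epsilon> / 2 / 2 ^ Suc n"
      using order_trans[OF r'(2) divide_right_mono[OF h(3), of 2]] by (simp add: mult.commute)
    ultimately have "inv (Suc n) (?h + g, r')"
      using r'(1) convex_cone_add[OF PS(3) h(1) g(1)] by (simp add: inv_def)
    moreover have "N (?h + g - ?h) \<le> ?r - r'" using g(2) r'(2) by simp
    ultimately show ?thesis by (intro exI[of _ "(?h + g, r')"]) simp
  qed
  ultimately obtain p where p: "\<And>n. inv n (p n)"
      and step: "\<And>n. N (fst (p (Suc n)) - fst (p n)) \<le> snd (p n) - snd (p (Suc n))"
    using dependent_nat_choice[of inv "\<lambda>n p q. N (fst q - fst p) \<le> snd p - snd q"] by blast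
  define u r where "u n = fst (p n)" and "r n = snd (p n)" for n
  have ur: "u n \<in> P" "r n > 0" "r n \<le> \<epsilon> / 2 / 2 ^ n" for n
    using p[of n] by (auto simp: inv_def u_def r_def)
  have net: "has_finite_net (\<epsilon> / 2 ^ n) (Omega (\<lambda>y. f y + ereal (u n y)) S (4 * c * r n))"
    if "n > 0" for n using p[of n] that by (auto simp: inv_def u_def r_def)
  \<comment> \<open>The \<open>n = 0\<close> clause of \<open>inv\<close> pins the starting point
    that dependent choice leaves free; it turns the bound on \<open>N (g - u 0)\<close> into
    \<open>N g \<le> \<epsilon> / 2\<close>.\<close>
  have start: "u 0 = 0" "r 0 = \<epsilon> / 2" using p[of 0] by (auto simp: inv_def u_def r_def)
  have geo: "(\<lambda>n. a / 2 ^ n) \<longlonglongrightarrow> 0" for a :: real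
    by (rule LIMSEQ_divide_realpow_zero) simp
  have "r \<longlonglongrightarrow> 0"
    by (rule tendsto_sandwich[OF _ _ tendsto_const geo[of "\<epsilon> / 2"]])
      (use ur in \<open>auto intro!: always_eventually less_imp_le\<close>)
  moreover have "r n \<ge> 0" for n using ur(2)[of n] by simp
  moreover have "N (u (Suc n) - u n) \<le> r n - r (Suc n)" for n
    using step by (simp add: u_def r_def)
  ultimately obtain g where g: "g \<in> P" "\<And>n. N (g - u n) \<le> r n"
    using norm_on_controlled_limit[OF norm subspace_span complete span_superset, of u r] ur(1)
    by blast
  have "N g < \<epsilon>" using g(2)[of 0] start assms(8) by simp
  moreover have "well_posed_modulus_compact (\<lambda>x. f x + ereal (g x)) S"
  proof (rule well_posed_modulus_compactI[OF assms(2,1) fin[OF g(1)]])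
    fix x :: "nat \<Rightarrow> 'a" and l
    assume x: "\<And>n. x n \<in> S" "x \<longlonglongrightarrow> l"
      "(\<lambda>n. f (x n) + ereal (g (x n))) \<longlonglongrightarrow> (INF y\<in>S. f y + ereal (g y))"
    have "l \<in> S" using assms(2) x(1,2) by (metis closed_sequentially)
    then show "f l + ereal (g l) \<le> (INF y\<in>S. f y + ereal (g y))"
      using lower_semicontinuous_add_le_lim[OF assms(5) PS(1)[OF g(1)]] x by blast
  next
    fix e :: real assume "e > 0"
    then have "\<forall>\<^sub>F n in sequentially. \<epsilon> / 2 ^ n < e"
      using geo order_tendstoD(2) by blast
    \<comment> \<open>Index 0 is excluded because \<open>inv\<close> provides no net before the
      first perturbation.\<close>
    then have "\<forall>\<^sub>F n in sequentially. n > 0 \<and> \<epsilon> / 2 ^ n < e"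
      using eventually_conj[OF eventually_gt_at_top[of "0::nat"]] by blast
    then obtain n where n: "n > 0" "\<epsilon> / 2 ^ n < e"
      by (auto simp: eventually_sequentially)
    have "\<bar>g x - u n x\<bar> \<le> c * r n" if "x \<in> S" for x
      using diff_bound[OF g(1) ur(1) that, of n] g(2)[of n] c(1)
      by (meson mult_left_mono less_imp_le order_trans)
    \<comment> \<open>Half of the slack \<open>4 * c * r n\<close> serves as level for the limit
      function; the other half absorbs twice the uniform error \<open>c * r n\<close>.\<close>
    then have "Omega (\<lambda>x. f x + ereal (g x)) S (2 * c * r n)
        \<subseteq> Omega (\<lambda>x. f x + ereal (u n x)) S (2 * c * r n + 2 * (c * r n))"
      by (rule Omega_perturbation_subset)
    then have "has_finite_net e (Omega (\<lambda>x. f x + ereal (g x)) S (2 * c * r n))"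
      using net[OF n(1)] n(2) by (elim has_finite_net_mono) (auto simp: algebra_simps)
    then show "\<exists>t>0. has_finite_net e (Omega (\<lambda>x. f x + ereal (g x)) S t)"
      using c(1) ur(2)[of n] by (intro exI[of _ "2 * c * r n"]) simp
  qed
  moreover from this obtain x where "x \<in> Omega (\<lambda>x. f x + ereal (g x)) S 0"
    unfolding well_posed_modulus_compact_def by blast
  then have "x \<in> S \<and> (\<forall>y\<in>S. f x + ereal (g x) \<le> f y + ereal (g y))"
    by (simp add: mem_Omega_iff)
  ultimately show ?thesis using g(1) by blast
qed

end
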